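(* Let $h\ge 1$ be an integer, assume $\boldsymbol{\gamma}_0$ and $\boldsymbol{\gamma}_h$ are linearly independent vectors in $\mathbb{R}^L$, and let $\alpha_0\in\mathbb{R}$. Then the solution of the problem $$\min_{\mathbf{b}\in\mathbb{R}^L}\ (\mathbf{b}-\boldsymbol{\gamma}_h)'(\mathbf{b}-\boldsymbol{\gamma}_h)\quad\text{subject to}\quad \boldsymbol{\gamma}_0'\mathbf{b}=\alpha_0$$ is $$\mathbf{b}=\boldsymbol{\gamma}_h+\lambda\boldsymbol{\gamma}_0,\qquad \lambda=\frac{\alpha_0-\boldsymbol{\gamma}_h'\boldsymbol{\gamma}_0}{\boldsymbol{\gamma}_0'\boldsymbol{\gamma}_0}.$$
   Context: $(\gamma_k)_{k\in\mathbb{Z}}$ is a square-summable real sequence, $L\ge 1$ is an integer, and for each integer $h\ge 0$ we set $\boldsymbol{\gamma}_h:=(\gamma_h,\gamma_{h+1},\dots,\gamma_{h+L-1})'\in\mathbb{R}^L$. A prime denotes transposition. *)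

theory Defs
  imports "HOL-Analysis.Infinite_Sum" "Jordan_Normal_Form.VS_Connect"
begin

definition gamma_vec :: "(int \<Rightarrow> real) \<Rightarrow> nat \<Rightarrow> nat \<Rightarrow> real vec" where
  "gamma_vec \<gamma> L h = vec L (\<lambda>i. \<gamma> (int h + int i))"

(* lin_indpt speaks about sets, so the two entries of the pair must also be
   required to be distinct; otherwise v = w \<noteq> 0 would count as independent. *)
definition lin_indpt_pair :: "nat \<Rightarrow> real vec \<Rightarrow> real vec \<Rightarrow> bool" where
  "lin_indpt_pair n v w \<longleftrightarrow>
     v \<noteq> w \<and> module.lin_indpt class_ring (module_vec TYPE(real) n) {v, w}"

end

theory Submission
  imports Defs
begin

text \<open>The candidate p differs from c by a multiple of u, and every feasible b has b - p
  orthogonal to u. So by Pythagoras the squared distance from b to c exceeds that from p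
  by the squared norm of b - p.\<close>

text \<open>Conjugation is the identity on real vectors, so positivity of the conjugate scalar
  product carries over to \<open>\<bullet>\<close>.\<close>

lemma scalar_prod_self_nonneg: "0 \<le> v \<bullet> (v :: real vec)"
  using conjugate_square_ge_0_vec[of v] by simp

lemma scalar_prod_self_eq_0_iff:
  assumes "v \<in> carrier_vec n"
  shows "v \<bullet> (v :: real vec) = 0 \<longleftrightarrow> v = 0\<^sub>v n"
  using conjugate_square_eq_0_vec[OF assms] by simp

text \<open>A set containing the zero vector is dependent. This makes the denominator of the
  multiplier nonzero.\<close>

lemma lin_indpt_pair_nonzero:
  assumes "v \<in> carrier_vec n" "w \<in> carrier_vec n" "lin_indpt_pair n v w"
  shows "v \<noteq> 0\<^sub>v n"
proof -
  interpret vec_space "TYPE(real)" n .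
  have "lin_indpt {v, w}"
    using assms(3) by (simp add: lin_indpt_pair_def)
  then show ?thesis
    using vs_zero_lin_dep[of "{v, w}"] assms(1,2) by (auto simp: module_vec_simps)
qed

text \<open>Here \<open>l\<close> is arbitrary: it is enough that \<open>b\<close> and
  \<open>p\<close> lie on the same level set of \<open>u\<close>, since the mixed terms then
  vanish.\<close>

lemma hyperplane_pythagoras:
  fixes u c b :: "real vec"
  assumes u: "u \<in> carrier_vec n" and c: "c \<in> carrier_vec n" and b: "b \<in> carrier_vec n"
    and "u \<bullet> b = u \<bullet> (c + l \<cdot>\<^sub>v u)"
  defines "p \<equiv> c + l \<cdot>\<^sub>v u"
  shows "(b - c) \<bullet> (b - c) = (p - c) \<bullet> (p - c) + (b - p) \<bullet> (b - p)"
proof -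
  have p: "p \<in> carrier_vec n"
    using u c by (simp add: p_def)
  have split: "b - c = (b - p) + l \<cdot>\<^sub>v u" and pc: "p - c = l \<cdot>\<^sub>v u"
    using u c b by (auto simp: p_def)
  have orth: "u \<bullet> (b - p) = 0"
    using assms(4) scalar_prod_minus_distrib[OF u b p] by (simp add: p_def)
  \<comment> \<open>Expanding the square yields mixed terms in both orders, and commutativity of
    \<open>\<bullet>\<close> depends on the dimensions agreeing.\<close>
  then have "(b - p) \<bullet> u = 0"
    using comm_scalar_prod[of u n "b - p"] u b p by simp
  with orth show ?thesis
    unfolding split pc using u b p
    by (simp add: scalar_prod_add_distrib[of _ n] add_scalar_prod_distrib[of _ n])
qed

text \<open>The minimizer is the foot of the perpendicular from \<open>c\<close> to the hyperplane.
  The equivalence covers both existence and uniqueness.\<close>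

lemma is_arg_min_hyperplane:
  fixes u c :: "real vec"
  assumes u: "u \<in> carrier_vec n" and c: "c \<in> carrier_vec n" and "u \<noteq> 0\<^sub>v n"
  shows "is_arg_min (\<lambda>b. (b - c) \<bullet> (b - c)) (\<lambda>b. b \<in> carrier_vec n \<and> u \<bullet> b = a) b
    \<longleftrightarrow> b = c + ((a - c \<bullet> u) / (u \<bullet> u)) \<cdot>\<^sub>v u"
proof -
  define p where "p = c + ((a - c \<bullet> u) / (u \<bullet> u)) \<cdot>\<^sub>v u"
  have p: "p \<in> carrier_vec n"
    using u c by (simp add: p_def)
  have "u \<bullet> u \<noteq> 0"
    using assms scalar_prod_self_eq_0_iff by blast
  \<comment> \<open>The coefficient in \<open>p\<close> is the solution \<open>l\<close> of
    \<open>u \<bullet> (c + l \<cdot>\<^sub>v u) = a\<close>.\<close>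
  then have up: "u \<bullet> p = a"
    using u c by (simp add: p_def scalar_prod_add_distrib[of _ n] comm_scalar_prod[of u n c])
  have pyth: "(x - c) \<bullet> (x - c) = (p - c) \<bullet> (p - c) + (x - p) \<bullet> (x - p)"
    if "x \<in> carrier_vec n" "u \<bullet> x = a" for x
    using hyperplane_pythagoras[OF u c that(1)] that(2) up unfolding p_def by simp
  \<comment> \<open>Uniqueness: a minimizer \<open>x\<close> is not beaten by the feasible point
    \<open>p\<close>, which forces the excess \<open>(x - p) \<bullet> (x - p)\<close> to be
    zero.\<close>
  have "x = p" if x: "x \<in> carrier_vec n" "u \<bullet> x = a" and "\<not> (p - c) \<bullet> (p - c) < (x - c) \<bullet> (x - c)" for x
  proof -
    have "(x - p) \<bullet> (x - p) = 0"
      using pyth[OF x] that(3) scalar_prod_self_nonneg[of "x - p"] by linarith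
    then have "x - p = 0\<^sub>v n"
      using scalar_prod_self_eq_0_iff[of "x - p" n] x p by simp
    then show "x = p"
      using x p by (auto simp: vec_eq_iff)
  qed
  moreover have "\<not> (x - c) \<bullet> (x - c) < (p - c) \<bullet> (p - c)"
    if "x \<in> carrier_vec n" "u \<bullet> x = a" for x
    using pyth[OF that] scalar_prod_self_nonneg[of "x - p"] by linarith
  ultimately show ?thesis
    unfolding is_arg_min_def p_def[symmetric] using p up by blast
qed

theorem proposition1:
  fixes \<gamma> :: "int \<Rightarrow> real" and L h :: nat and \<alpha>0 :: real
  assumes "(\<lambda>k. (\<gamma> k)\<^sup>2) summable_on UNIV"
    and "L \<ge> 1"
    and "h \<ge> 1"
    and "lin_indpt_pair L (gamma_vec \<gamma> L 0) (gamma_vec \<gamma> L h)"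
  shows "let \<gamma>0 = gamma_vec \<gamma> L 0;
             \<gamma>h = gamma_vec \<gamma> L h;
             lam = (\<alpha>0 - \<gamma>h \<bullet> \<gamma>0) / (\<gamma>0 \<bullet> \<gamma>0)
         in {b. is_arg_min (\<lambda>b. (b - \<gamma>h) \<bullet> (b - \<gamma>h))
                  (\<lambda>b. b \<in> carrier_vec L \<and> \<gamma>0 \<bullet> b = \<alpha>0) b}
            = {\<gamma>h + lam \<cdot>\<^sub>v \<gamma>0}"
proof -
  have carrier: "gamma_vec \<gamma> L k \<in> carrier_vec L" for k
    by (simp add: gamma_vec_def)
  show ?thesis
    \<comment> \<open>Take \<open>u\<close> to be the vector at lag 0 and \<open>c\<close> the one
      at lag \<open>h\<close>. The equivalence for each \<open>b\<close> is the equality with the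
      singleton.\<close>
    using is_arg_min_hyperplane[OF carrier carrier lin_indpt_pair_nonzero[OF carrier carrier assms(4)]]
    by (simp add: Let_def set_eq_iff)
qed

end
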